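(* Let $I=(R,\pi)$ be an interpreted system and $i\in\mathcal A$ an agent such that the formula $correct_i\wedge\neg\overline{start}$ is potentially persistent in $I$. Then $$I\models B_i E^{\lozenge H}\,\overline{start}\to B_i\,\overline{start}\qquad\text{and}\qquad I\models B_i C^{\lozenge H}\,\overline{start}\to B_i\,\overline{start}.$$
   Context: Model. $\mathcal A=\{1,\dots,n\}$ is a finite set of agents; time ranges over $\mathbb N$. A run $r$ assigns to each $t\in\mathbb N$ a global state $r(t)=(r_\epsilon(t),r_1(t),\dots,r_n(t))$ consisting of the environment state and the local state (local history) $r_i(t)$ of each agent $i$. Agents may become byzantine faulty. An interpreted system is a pair $I=(R,\pi)$ with $R$ a set of runs and $\pi$ a valuation of atomic propositions at points $(r,t)$, $r\in R$, $t\in\mathbb N$. Formulas are built from atomic propositions by Boolean connectives, $K_i$ ($i\in\mathcal A$), $\lozenge$, $Y$, with $\Box\varphi:=\neg\lozenge\neg\varphi$. Semantics: $(I,r,t)\models K_i\varphi$ iff $(I,r',t')\models\varphi$ for all $r'\in R$, $t'\in\mathbb N$ with $r_i(t)=r'_i(t')$; $(I,r,t)\models\lozenge\varphi$ iff $(I,r,t')\models\varphi$ for some $t'\ge t$; $(I,r,t)\models Y\varphi$ iff $t>0$ and $(I,r,t-1)\models\varphi$. $I\models\varphi$ means $\varphi$ holds at all points $(r,t)$ with $r\in R$, $t\in\mathbb N$. Designated atoms: $correct_i$ holds at $(r,t)$ iff no faulty event happened to $i$ in $r$ by time $t$ (so once false in a run it stays false); $\overline{occurred}_i(\mathrm{START})$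 holds at $(r,t)$ iff $r_i(t)$ contains an accurate record of the event START occurring. Abbreviations: $\overline{start}_i:=Y\,\overline{occurred}_i(\mathrm{START})\wedge correct_i$; $\overline{start}:=\bigvee_{j\in\mathcal A}\overline{start}_j$. Belief: $B_i\varphi:=K_i(correct_i\to\varphi)$. Hope: $H_i\varphi:=correct_i\to B_i\varphi$. Eventual mutual hope: $E^{\lozenge H}\varphi:=\bigwedge_{j\in\mathcal A}\lozenge H_j\varphi$. Eventual common hope $C^{\lozenge H}\varphi$ is the greatest fixed point of $\chi\leftrightarrow E^{\lozenge H}(\varphi\wedge\chi)$, i.e. it holds exactly on the greatest set $X$ of points such that $X$ equals the set of points satisfying $E^{\lozenge H}(\varphi\wedge\chi)$ when $\chi$ is interpreted as $X$. A formula $\varphi$ is potentially persistent in $I=(R,\pi)$ if for every $r\in R$ and $t\in\mathbb N$ with $(I,r,t)\models\varphi$ there is $r'\in R$ with $r'(t)=r(t)$ and $(I,r',t)\models\Box\varphi$. *)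

theory Defs
  imports Main
begin

text \<open>
  A global state consists of the environment state and the local states of all agents; the
  finite set of agents is the universe of the type \<open>'a\<close>, which is of class \<open>finite\<close> wherever
  a conjunction or disjunction over all agents is formed.
\<close>

type_synonym ('a, 'e, 'l) global_state = "'e \<times> ('a \<Rightarrow> 'l)"
type_synonym ('a, 'e, 'l) run = "nat \<Rightarrow> ('a, 'e, 'l) global_state"

definition local_state :: "('a, 'e, 'l) run \<Rightarrow> 'a \<Rightarrow> nat \<Rightarrow> 'l" where
  "local_state r i t = snd (r t) i"

datatype ('a, 'p) atom = Correct 'a | Occurred_START 'a | Prop 'p

record ('a, 'e, 'l, 'p) interpreted_system =
  runs :: "('a, 'e, 'l) run set"
  val :: "('a, 'p) atom \<Rightarrow> ('a, 'e, 'l) run \<Rightarrow> nat \<Rightarrow> bool"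

text \<open>
  An event model supplies what the two designated families of atoms talk about:
  \<open>happens M r t i e\<close> means that event \<open>e\<close> happens to agent \<open>i\<close> in run \<open>r\<close> at time \<open>t\<close>;
  \<open>records M l\<close> are the records contained in the local history \<open>l\<close>; and
  \<open>accurate M r t i \<rho> e\<close> means that, judged by what really took place in \<open>r\<close> up to time \<open>t\<close>,
  the record \<open>\<rho>\<close> of agent \<open>i\<close> is an accurate record of \<open>e\<close> occurring (a byzantine agent may
  also hold fake records, so accuracy is not a function of the local history alone).
\<close>

record ('a, 'e, 'l, 'ev, 'rec) event_model =
  happens :: "('a, 'e, 'l) run \<Rightarrow> nat \<Rightarrow> 'a \<Rightarrow> 'ev \<Rightarrow> bool"
  faulty :: "'ev \<Rightarrow> bool"
  START :: 'ev
  records :: "'l \<Rightarrow> 'rec set"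
  accurate :: "('a, 'e, 'l) run \<Rightarrow> nat \<Rightarrow> 'a \<Rightarrow> 'rec \<Rightarrow> 'ev \<Rightarrow> bool"

definition interprets_designated_atoms ::
  "('a, 'e, 'l, 'ev, 'rec) event_model \<Rightarrow> ('a, 'e, 'l, 'p) interpreted_system \<Rightarrow> bool" where
  "interprets_designated_atoms M I \<longleftrightarrow>
     (\<forall>r\<in>runs I. \<forall>t i.
        (val I (Correct i) r t \<longleftrightarrow> \<not> (\<exists>t'\<le>t. \<exists>e. faulty M e \<and> happens M r t' i e)) \<and>
        (val I (Occurred_START i) r t \<longleftrightarrow>
           (\<exists>\<rho>\<in>records M (local_state r i t). accurate M r t i \<rho> (START M))))"

text \<open>
  Formulas are embedded shallowly: \<open>\<phi> I r t\<close> is the satisfaction of \<open>\<phi>\<close> at the point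
  \<open>(r, t)\<close> of \<open>I\<close>. It is only meant to be used for \<open>r \<in> runs I\<close>.
\<close>

type_synonym ('a, 'e, 'l, 'p) formula =
  "('a, 'e, 'l, 'p) interpreted_system \<Rightarrow> ('a, 'e, 'l) run \<Rightarrow> nat \<Rightarrow> bool"

definition Atom :: "('a, 'p) atom \<Rightarrow> ('a, 'e, 'l, 'p) formula" where
  "Atom a = (\<lambda>I r t. val I a r t)"

definition Neg :: "('a, 'e, 'l, 'p) formula \<Rightarrow> ('a, 'e, 'l, 'p) formula" where
  "Neg \<phi> = (\<lambda>I r t. \<not> \<phi> I r t)"

definition Conj ::
  "('a, 'e, 'l, 'p) formula \<Rightarrow> ('a, 'e, 'l, 'p) formula \<Rightarrow> ('a, 'e, 'l, 'p) formula" where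
  "Conj \<phi> \<psi> = (\<lambda>I r t. \<phi> I r t \<and> \<psi> I r t)"

definition Imp ::
  "('a, 'e, 'l, 'p) formula \<Rightarrow> ('a, 'e, 'l, 'p) formula \<Rightarrow> ('a, 'e, 'l, 'p) formula" where
  "Imp \<phi> \<psi> = (\<lambda>I r t. \<phi> I r t \<longrightarrow> \<psi> I r t)"

definition Conj_agents ::
  "('a::finite \<Rightarrow> ('a, 'e, 'l, 'p) formula) \<Rightarrow> ('a, 'e, 'l, 'p) formula" where
  "Conj_agents \<phi> = (\<lambda>I r t. \<forall>j. \<phi> j I r t)"

definition Disj_agents ::
  "('a::finite \<Rightarrow> ('a, 'e, 'l, 'p) formula) \<Rightarrow> ('a, 'e, 'l, 'p) formula" where
  "Disj_agents \<phi> = (\<lambda>I r t. \<exists>j. \<phi> j I r t)"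

definition Know :: "'a \<Rightarrow> ('a, 'e, 'l, 'p) formula \<Rightarrow> ('a, 'e, 'l, 'p) formula" where
  "Know i \<phi> = (\<lambda>I r t. \<forall>r'\<in>runs I. \<forall>t'. local_state r i t = local_state r' i t' \<longrightarrow> \<phi> I r' t')"

definition Dia :: "('a, 'e, 'l, 'p) formula \<Rightarrow> ('a, 'e, 'l, 'p) formula" where
  "Dia \<phi> = (\<lambda>I r t. \<exists>t'\<ge>t. \<phi> I r t')"

definition Box :: "('a, 'e, 'l, 'p) formula \<Rightarrow> ('a, 'e, 'l, 'p) formula" where
  "Box \<phi> = Neg (Dia (Neg \<phi>))"

definition Yesterday :: "('a, 'e, 'l, 'p) formula \<Rightarrow> ('a, 'e, 'l, 'p) formula" where
  "Yesterday \<phi> = (\<lambda>I r t. t > 0 \<and> \<phi> I r (t - 1))"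

definition valid :: "('a, 'e, 'l, 'p) interpreted_system \<Rightarrow> ('a, 'e, 'l, 'p) formula \<Rightarrow> bool" where
  "valid I \<phi> \<longleftrightarrow> (\<forall>r\<in>runs I. \<forall>t. \<phi> I r t)"

definition correct :: "'a \<Rightarrow> ('a, 'e, 'l, 'p) formula" where
  "correct i = Atom (Correct i)"

definition start_at :: "'a \<Rightarrow> ('a, 'e, 'l, 'p) formula" where
  "start_at i = Conj (Yesterday (Atom (Occurred_START i))) (correct i)"

definition start :: "('a::finite, 'e, 'l, 'p) formula" where
  "start = Disj_agents start_at"

definition Believe :: "'a \<Rightarrow> ('a, 'e, 'l, 'p) formula \<Rightarrow> ('a, 'e, 'l, 'p) formula" where
  "Believe i \<phi> = Know i (Imp (correct i) \<phi>)"

definition Hope :: "'a \<Rightarrow> ('a, 'e, 'l, 'p) formula \<Rightarrow> ('a, 'e, 'l, 'p) formula" where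
  "Hope i \<phi> = Imp (correct i) (Believe i \<phi>)"

definition Ev_Mutual_Hope :: "('a::finite, 'e, 'l, 'p) formula \<Rightarrow> ('a, 'e, 'l, 'p) formula" where
  "Ev_Mutual_Hope \<phi> = Conj_agents (\<lambda>j. Dia (Hope j \<phi>))"

text \<open>
  The formula variable \<open>\<chi>\<close> interpreted as the set \<open>X\<close> of points is \<open>\<lambda>_ r t. (r, t) \<in> X\<close>.
  The operator below is monotone for every \<open>\<phi>\<close>, so that \<open>gfp\<close> indeed yields its greatest
  fixed point.
\<close>

definition mutual_hope_op ::
  "('a::finite, 'e, 'l, 'p) interpreted_system \<Rightarrow> ('a, 'e, 'l, 'p) formula \<Rightarrow>
   (('a, 'e, 'l) run \<times> nat) set \<Rightarrow> (('a, 'e, 'l) run \<times> nat) set" where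
  "mutual_hope_op I \<phi> X =
     {(r, t). r \<in> runs I \<and> Ev_Mutual_Hope (Conj \<phi> (\<lambda>_ r t. (r, t) \<in> X)) I r t}"

definition Ev_Common_Hope :: "('a::finite, 'e, 'l, 'p) formula \<Rightarrow> ('a, 'e, 'l, 'p) formula" where
  "Ev_Common_Hope \<phi> = (\<lambda>I r t. (r, t) \<in> gfp (mutual_hope_op I \<phi>))"

lemma mono_mutual_hope_op:
  fixes I :: "('a::finite, 'e, 'l, 'p) interpreted_system"
  shows "mono (mutual_hope_op I \<phi>)"
proof (rule monoI)
  fix X Y :: "(('a, 'e, 'l) run \<times> nat) set"
  assume "X \<subseteq> Y"
  then show "mutual_hope_op I \<phi> X \<subseteq> mutual_hope_op I \<phi> Y"
    unfolding mutual_hope_op_def Ev_Mutual_Hope_def Conj_agents_def Dia_def Hope_def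
      Believe_def Know_def Imp_def Conj_def
    by clarsimp (meson subsetD)
qed

lemma Ev_Common_Hope_fixed_point:
  "{(r, t). Ev_Common_Hope \<phi> I r t} = mutual_hope_op I \<phi> {(r, t). Ev_Common_Hope \<phi> I r t}"
  using gfp_unfold[OF mono_mutual_hope_op] by (simp add: Ev_Common_Hope_def)

lemma Ev_Common_Hope_greatest:
  "X = mutual_hope_op I \<phi> X \<Longrightarrow> X \<subseteq> {(r, t). Ev_Common_Hope \<phi> I r t}"
  using gfp_upperbound[of X "mutual_hope_op I \<phi>"] by (simp add: Ev_Common_Hope_def)

definition potentially_persistent ::
  "('a, 'e, 'l, 'p) interpreted_system \<Rightarrow> ('a, 'e, 'l, 'p) formula \<Rightarrow> bool" where
  "potentially_persistent I \<phi> \<longleftrightarrow>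
     (\<forall>r\<in>runs I. \<forall>t. \<phi> I r t \<longrightarrow> (\<exists>r'\<in>runs I. r' t = r t \<and> Box \<phi> I r' t))"

end

theory Submission
  imports Defs
begin

text \<open>
  Suppose \<open>\<phi>\<close> fails at a point that \<open>i\<close> considers possible while correct. By potential
  persistence the global state of that point also occurs in a run in which \<open>i\<close> stays correct and
  \<open>\<phi>\<close> stays false forever. Agent \<open>i\<close> considers this point possible too, so at some later time of
  this run \<open>i\<close> hopes \<open>\<phi>\<close>; as \<open>i\<close> is correct and considers the actual point possible, \<open>\<phi>\<close> holds
  there, a contradiction.
\<close>

lemma Believe_mono:
  assumes "\<And>r t. r \<in> runs I \<Longrightarrow> \<phi> I r t \<Longrightarrow> \<psi> I r t"
    and "Believe i \<phi> I r t"
  shows "Believe i \<psi> I r t"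
  using assms by (simp add: Believe_def Know_def Imp_def)

lemma Hope_mono:
  assumes "\<And>r t. r \<in> runs I \<Longrightarrow> \<phi> I r t \<Longrightarrow> \<psi> I r t"
    and "Hope i \<phi> I r t"
  shows "Hope i \<psi> I r t"
  using assms by (auto simp: Hope_def Imp_def intro: Believe_mono)

text \<open>Indistinguishability is reflexive: since \<open>r\<close> is a run of \<open>I\<close>,
  the point \<open>(r, t)\<close> itself is among those that the belief of \<open>i\<close> ranges
  over.\<close>

lemma Hope_correctD:
  assumes "r \<in> runs I" "Hope i \<phi> I r t" "correct i I r t"
  shows "\<phi> I r t"
  using assms by (auto simp: Hope_def Believe_def Know_def Imp_def)

lemma Ev_Mutual_Hope_imp_Dia_Hope: "Ev_Mutual_Hope \<phi> I r t \<Longrightarrow> Dia (Hope i \<phi>) I r t"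
  by (simp add: Ev_Mutual_Hope_def Conj_agents_def)

lemma Ev_Mutual_Hope_mono:
  assumes "\<And>r t. r \<in> runs I \<Longrightarrow> \<phi> I r t \<Longrightarrow> \<psi> I r t"
    and "Ev_Mutual_Hope \<phi> I r t"
  shows "Ev_Mutual_Hope \<psi> I r t"
  using assms Hope_mono[of I \<phi> \<psi>]
  unfolding Ev_Mutual_Hope_def Conj_agents_def Dia_def by blast

text \<open>One unfolding of the fixed point gives eventual mutual hope of \<open>\<phi>\<close>
  conjoined with common hope; monotonicity drops the second conjunct.\<close>

lemma Ev_Common_Hope_imp_Ev_Mutual_Hope:
  assumes "Ev_Common_Hope \<phi> I r t"
  shows "Ev_Mutual_Hope \<phi> I r t"
proof -
  have "(r, t) \<in> mutual_hope_op I \<phi> {(r, t). Ev_Common_Hope \<phi> I r t}"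
    using assms Ev_Common_Hope_fixed_point by blast
  then show ?thesis
    by (auto simp: mutual_hope_op_def Conj_def elim!: Ev_Mutual_Hope_mono[rotated])
qed

lemma Believe_Dia_Hope_imp_Believe:
  assumes persistent: "potentially_persistent I (Conj (correct i) (Neg \<phi>))"
    and believes: "Believe i (Dia (Hope i \<phi>)) I r t"
  shows "Believe i \<phi> I r t"
proof (rule ccontr)
  assume "\<not> Believe i \<phi> I r t"
  then obtain r' t' where r': "r' \<in> runs I" "local_state r i t = local_state r' i t'"
      "Conj (correct i) (Neg \<phi>) I r' t'"
    by (auto simp: Believe_def Know_def Imp_def Conj_def Neg_def)
  then obtain r'' where r'': "r'' \<in> runs I" "r'' t' = r' t'"
      and "Box (Conj (correct i) (Neg \<phi>)) I r'' t'"
    using persistent unfolding potentially_persistent_def by blast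
  then have forever: "correct i I r'' u \<and> \<not> \<phi> I r'' u" if "u \<ge> t'" for u
    using that by (auto simp: Box_def Dia_def Neg_def Conj_def)
  \<comment> \<open>The runs \<open>r'\<close> and \<open>r''\<close> share the whole global state
    at \<open>t'\<close>, hence also the local state of \<open>i\<close>.\<close>
  have "local_state r i t = local_state r'' i t'"
    using r' r'' by (simp add: local_state_def)
  then have "Dia (Hope i \<phi>) I r'' t'"
    using believes r''(1) forever[of t'] by (simp add: Believe_def Know_def Imp_def)
  then obtain u where "u \<ge> t'" "Hope i \<phi> I r'' u"
    by (auto simp: Dia_def)
  then show False
    using Hope_correctD[OF r''(1)] forever by blast
qed

theorem corollary24:
  fixes I :: "('a::finite, 'e, 'l, 'p) interpreted_system"
    and M :: "('a, 'e, 'l, 'ev, 'rec) event_model"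
    and i :: 'a
  assumes "interprets_designated_atoms M I"
    and "potentially_persistent I (Conj (correct i) (Neg start))"
  shows "valid I (Imp (Believe i (Ev_Mutual_Hope start)) (Believe i start)) \<and>
    valid I (Imp (Believe i (Ev_Common_Hope start)) (Believe i start))"
proof -
  \<comment> \<open>Inside the belief, mutual hope is weakened to the conjunct of \<open>i\<close>
    itself.\<close>
  have mutual: "Believe i start I r t" if "Believe i (Ev_Mutual_Hope start) I r t" for r t
    using assms(2) that
    by (blast intro: Believe_Dia_Hope_imp_Believe Believe_mono Ev_Mutual_Hope_imp_Dia_Hope)
  have "Believe i start I r t" if "Believe i (Ev_Common_Hope start) I r t" for r t
    using that by (blast intro: mutual Believe_mono Ev_Common_Hope_imp_Ev_Mutual_Hope)
  with mutual show ?thesis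
    by (simp add: valid_def Imp_def)
qed

end
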